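(* Let $n,k$ be integers with $7\le k\le \frac{n-1}{2}$ and $n\ge 10k+10$. Then the generalized Petersen graph $P(n,k)$ satisfies \[ Z_{(2)}(P(n,k))\le \left\lceil \frac{n}{4k+4}\right\rceil (2k+2). \]
   Context: All graphs are finite, simple and undirected. Let $G$ be a graph, $S\subseteq V(G)$ a set of initially blue vertices (all other vertices white), and $L\subseteq V(G)$ a set of leaks. The leaky color change rule: a blue vertex $b\notin L$ which has exactly one white neighbor $w$ may force $w$ to become blue. $S$ is an $\ell$-leaky forcing set if for every choice of a set $L$ of $\ell$ leaks, repeated application of the rule eventually turns all vertices blue. $Z_{(\ell)}(G)$ is the minimum size of an $\ell$-leaky forcing set of $G$. For $n\ge 3$ and $1\le k\le \frac{n-1}{2}$, the generalized Petersen graph $P(n,k)$ has vertex set $\{x_1,\dots,x_n,y_1,\dots,y_n\}$ and edge set $\{y_iy_{i+1}:1\le i\le n\}\cup\{x_iy_i:1\le i\le n\}\cup\{x_ix_{i+k}:1\le i\le n\}$, with indices taken modulo $n$. *)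

theory Defs
  imports Complex_Main "Graph_Theory.Pair_Digraph"
begin

text \<open>
  A finite simple undirected graph is an instance of the locale \<^locale>\<open>pair_graph\<close>: the arc
  relation is symmetric and irreflexive, and an edge \<open>uv\<close> is the pair of arcs \<open>(u,v)\<close>, \<open>(v,u)\<close>.
\<close>

definition white_neighbors :: "'a pair_pre_digraph \<Rightarrow> 'a set \<Rightarrow> 'a \<Rightarrow> 'a set" where
  "white_neighbors G B b = {w \<in> pverts G. (b, w) \<in> parcs G \<and> w \<notin> B}"

text \<open>
  One application of the leaky color change rule, turning the set \<open>B\<close> of blue vertices
  into \<open>B'\<close>.
\<close>

definition leaky_step :: "'a pair_pre_digraph \<Rightarrow> 'a set \<Rightarrow> 'a set \<Rightarrow> 'a set \<Rightarrow> bool" where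
  "leaky_step G L B B' \<longleftrightarrow>
     (\<exists>b w. b \<in> B \<and> b \<notin> L \<and> white_neighbors G B b = {w} \<and> B' = insert w B)"

definition leaky_forcing_set :: "'a pair_pre_digraph \<Rightarrow> nat \<Rightarrow> 'a set \<Rightarrow> bool" where
  "leaky_forcing_set G l S \<longleftrightarrow> S \<subseteq> pverts G \<and>
     (\<forall>L. L \<subseteq> pverts G \<and> card L = l \<longrightarrow> (leaky_step G L)\<^sup>*\<^sup>* S (pverts G))"

definition leaky_forcing_number :: "nat \<Rightarrow> 'a pair_pre_digraph \<Rightarrow> nat" where
  "leaky_forcing_number l G = (LEAST m. \<exists>S. leaky_forcing_set G l S \<and> card S = m)"

lemma leaky_forcing_set_pverts: "leaky_forcing_set G l (pverts G)"
  by (simp add: leaky_forcing_set_def)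

lemma leaky_forcing_number_attained:
  "\<exists>S. leaky_forcing_set G l S \<and> card S = leaky_forcing_number l G"
  unfolding leaky_forcing_number_def
  by (rule LeastI_ex) (use leaky_forcing_set_pverts in blast)

lemma leaky_forcing_number_le:
  "leaky_forcing_set G l S \<Longrightarrow> leaky_forcing_number l G \<le> card S"
  unfolding leaky_forcing_number_def by (rule Least_le) blast

datatype petersen_vertex = X nat | Y nat

text \<open>
  Indices modulo \<open>n\<close> are represented by the residues \<open>0, \<dots>, n - 1\<close>, so the usual
  \<open>x\<^sub>n\<close> and \<open>y\<^sub>n\<close> are \<open>X 0\<close> and \<open>Y 0\<close>.
\<close>

definition petersen_edges :: "nat \<Rightarrow> nat \<Rightarrow> petersen_vertex rel" where
  "petersen_edges n k =
     {(Y i, Y ((i + 1) mod n)) | i. i < n} \<union>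
     {(X i, Y i) | i. i < n} \<union>
     {(X i, X ((i + k) mod n)) | i. i < n}"

definition generalized_petersen :: "nat \<Rightarrow> nat \<Rightarrow> petersen_vertex pair_pre_digraph" where
  "generalized_petersen n k =
     \<lparr> pverts = X ` {..<n} \<union> Y ` {..<n}, parcs = symcl (petersen_edges n k) \<rparr>"

lemma mod_add_neq_self:
  fixes i d n :: nat
  assumes "i < n" "0 < d" "d < n"
  shows "(i + d) mod n \<noteq> i"
  using assms by (cases "i + d < n") (auto simp: mod_if)

lemma pair_graph_generalized_petersen:
  assumes "n \<ge> 3" "1 \<le> k" "real k \<le> (real n - 1) / 2"
  shows "pair_graph (generalized_petersen n k)"
proof -
  let ?G = "generalized_petersen n k"
  have k: "0 < k" "k < n" using assms by (simp_all add: field_simps)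
  have fin: "finite (pverts ?G)"
    by (simp add: generalized_petersen_def)
  have wf: "parcs ?G \<subseteq> pverts ?G \<times> pverts ?G"
    using assms by (auto simp: generalized_petersen_def symcl_def petersen_edges_def)
  have "finite (parcs ?G)"
    using fin wf by (meson finite_SigmaI finite_subset)
  moreover have "fst e \<noteq> snd e" if "e \<in> parcs ?G" for e
    using that assms(1) k mod_add_neq_self[of _ n 1] mod_add_neq_self[of _ n k]
    by (fastforce simp: generalized_petersen_def symcl_def petersen_edges_def)
  moreover have "symmetric (with_proj ?G)"
    by (auto simp: symmetric_def generalized_petersen_def symcl_def intro!: symI)
  ultimately show ?thesis
    using fin wf by unfold_locales auto
qed

end

theory Submission
  imports Defs
begin

text \<open>
  The forcing set consists of the \<open>y\<^sub>r\<close> with \<open>r mod (4 k + 4) < 2 k + 2\<close>: runs of \<open>2 k + 2\<close>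
  consecutive blue outer vertices (\<^emph>\<open>windows\<close>), separated by gaps of at most \<open>2 k + 2\<close> white
  ones, except that the last run may be cut short by the end of the cycle. The number of blocks of
  length \<open>4 k + 4\<close> gives the bound on its size, so the work is to show that it withstands any two
  leaks.

  Forcing gets stuck exactly when the set \<open>W\<close> of white vertices is a fort: no blue vertex that
  is not a leak has exactly one neighbour in \<open>W\<close>. So it suffices to show that a fort which
  avoids the blue set is empty (lemma \<open>leaky_forcing_by_forts\<close>). This is a static question, and
  it is convenient to unroll the cycle: a fort becomes a pair of periodic predicates \<open>A\<close>, \<open>C\<close> on the
  integers, telling for which \<open>i\<close> the vertices \<open>x\<^sub>i\<close> and \<open>y\<^sub>i\<close> are white.

  A window without leaks starts a blue front: its inner \<open>y\<^sub>i\<close> make \<open>2 k\<close> consecutive \<open>x\<^sub>i\<close> blue,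
  and from then on \<open>x\<^bsub>t+1-k\<^esub>\<close> forces \<open>x\<^bsub>t+1\<^esub>\<close> and \<open>y\<^bsub>t+1\<^esub>\<close> forces \<open>y\<^bsub>t+2\<^esub>\<close>. The front runs in both
  directions until it meets the index of a leak (lemma \<open>sweep\<close>). As \<open>n \<ge> 10 k + 10\<close> there are
  three complete windows at distinct places, so that one of them is free of the two leaks, and all
  white vertices lie strictly between two leak indices \<open>a\<close> and \<open>b\<close>. If a complete window lies
  between \<open>a\<close> and \<open>b\<close>, then a second front starts from it and nothing is left. Otherwise the white
  \<open>y\<^sub>i\<close> between \<open>a\<close> and \<open>b\<close> come from a single gap and span at most \<open>2 k + 2\<close> indices.

  It remains to exclude such an \<^emph>\<open>island\<close> of white vertices (lemma \<open>island_empty\<close>). Near its left end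
  \<open>lo\<close> there is a white \<open>y\<^bsub>lo\<^esub>\<close> or \<open>y\<^bsub>lo+1\<^esub>\<close>, while a white \<open>x\<^sub>i\<close> with \<open>i \<noteq> lo\<close> has \<open>i \<ge> lo + k\<close>;
  this holds for either kind of leak at \<open>a\<close>, and symmetrically at the right end \<open>hi\<close>
  (lemma \<open>left_end\<close>). Since the island is narrow, \<open>hi - lo \<le> 2 k + 3\<close>. A blue \<open>y\<^sub>i\<close> next to a white
  one and with blue \<open>x\<^sub>i\<close> needs its other neighbour on the outer cycle to be white too, so the
  white \<open>y\<^sub>i\<close> near \<open>lo\<close> continue to the right with holes of at most one index until they meet a
  white \<open>x\<^sub>i\<close>, which is far away. Each such \<open>y\<^sub>i\<close> with \<open>i \<noteq> lo\<close>, however, needs a second white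
  neighbour of its blue \<open>x\<^sub>i\<close>, which can only be \<open>x\<^bsub>i+k\<^esub>\<close>, and in a narrow island the white \<open>x\<close>
  vertices are too few for that.
\<close>

section \<open>Stalled colourings on the line\<close>

text \<open>
  An unrolled fort: \<open>A i\<close> and \<open>C i\<close> mean that \<open>x\<^sub>i\<close> and \<open>y\<^sub>i\<close> are white, \<open>LX i\<close> and \<open>LY i\<close> that they
  are leaks. The six rules say that no blue vertex that is not a leak has exactly one white
  neighbour, one rule for each choice of this neighbour.
\<close>

locale stalled =
  fixes k :: int and A C LX LY :: "int \<Rightarrow> bool"
  assumes k_ge: "7 \<le> k"
    and x_right: "\<lbrakk>\<not> A i; \<not> LX i; A (i - k)\<rbrakk> \<Longrightarrow> A (i + k) \<or> C i"
    and x_left: "\<lbrakk>\<not> A i; \<not> LX i; A (i + k)\<rbrakk> \<Longrightarrow> A (i - k) \<or> C i"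
    and x_up: "\<lbrakk>\<not> A i; \<not> LX i; C i\<rbrakk> \<Longrightarrow> A (i - k) \<or> A (i + k)"
    and y_right: "\<lbrakk>\<not> C i; \<not> LY i; C (i - 1)\<rbrakk> \<Longrightarrow> C (i + 1) \<or> A i"
    and y_left: "\<lbrakk>\<not> C i; \<not> LY i; C (i + 1)\<rbrakk> \<Longrightarrow> C (i - 1) \<or> A i"
    and y_down: "\<lbrakk>\<not> C i; \<not> LY i; A i\<rbrakk> \<Longrightarrow> C (i - 1) \<or> C (i + 1)"
begin

lemma reflected: "stalled k (\<lambda>i. A (- i)) (\<lambda>i. C (- i)) (\<lambda>i. LX (- i)) (\<lambda>i. LY (- i))"
proof
  fix i
  have e: "- (i - k) = - i + k" "- (i + k) = - i - k" "- (i - 1) = - i + 1" "- (i + 1) = - i - 1"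
    by simp_all
  show "\<lbrakk>\<not> A (- i); \<not> LX (- i); A (- (i - k))\<rbrakk> \<Longrightarrow> A (- (i + k)) \<or> C (- i)"
    using x_left[of "- i"] unfolding e by blast
  show "\<lbrakk>\<not> A (- i); \<not> LX (- i); A (- (i + k))\<rbrakk> \<Longrightarrow> A (- (i - k)) \<or> C (- i)"
    using x_right[of "- i"] unfolding e by blast
  show "\<lbrakk>\<not> A (- i); \<not> LX (- i); C (- i)\<rbrakk> \<Longrightarrow> A (- (i - k)) \<or> A (- (i + k))"
    using x_up[of "- i"] unfolding e by blast
  show "\<lbrakk>\<not> C (- i); \<not> LY (- i); C (- (i - 1))\<rbrakk> \<Longrightarrow> C (- (i + 1)) \<or> A (- i)"
    using y_left[of "- i"] unfolding e by blast
  show "\<lbrakk>\<not> C (- i); \<not> LY (- i); C (- (i + 1))\<rbrakk> \<Longrightarrow> C (- (i - 1)) \<or> A (- i)"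
    using y_right[of "- i"] unfolding e by blast
  show "\<lbrakk>\<not> C (- i); \<not> LY (- i); A (- i)\<rbrakk> \<Longrightarrow> C (- (i - 1)) \<or> C (- (i + 1))"
    using y_down[of "- i"] unfolding e by blast
qed (use k_ge in auto)

text \<open>
  The front at \<open>t\<close> advances because \<open>x\<^bsub>t+1-k\<^esub>\<close> sees only blue vertices except perhaps \<open>x\<^bsub>t+1\<^esub>\<close>, and
  then \<open>y\<^bsub>t+1\<^esub>\<close> only blue ones except perhaps \<open>y\<^bsub>t+2\<^esub>\<close>. For this it needs the last \<open>2 k\<close> columns,
  which is what determines the length of a window.
\<close>

lemma sweep_right:
  assumes window: "\<And>i. s \<le> i \<Longrightarrow> i \<le> s + 2 * k + 1 \<Longrightarrow> \<not> C i"
    and clean: "\<And>i. s \<le> i \<Longrightarrow> i < a \<Longrightarrow> \<not> LX i \<and> \<not> LY i"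
    and a: "s + 2 * k + 1 < a"
    and i: "s < i" "i \<le> a"
  shows "\<not> A i \<and> \<not> C i"
proof -
  \<comment> \<open>The \<open>y\<close> side of the front is one step ahead of the \<open>x\<close> side. The \<open>x\<^sub>s\<close> at the edge of the window
    is not covered, as \<open>y\<^bsub>s-1\<^esub>\<close> may be white.\<close>
  have front: "t < a \<longrightarrow> (\<forall>i. s < i \<and> i \<le> t \<longrightarrow> \<not> A i) \<and> (\<forall>i. s \<le> i \<and> i \<le> t + 1 \<longrightarrow> \<not> C i)"
    if "s + 2 * k \<le> t" for t
    using that
  proof (induction t rule: int_ge_induct)
    case base
    show ?case
    proof (intro impI conjI allI)
      fix i assume "s < i \<and> i \<le> s + 2 * k"
      then show "\<not> A i"
        using y_down[of i] window[of i] window[of "i - 1"] window[of "i + 1"] clean[of i] a by auto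
    qed (use window in auto)
  next
    case (step t)
    show ?case
    proof
      assume ta: "t + 1 < a"
      from step ta have
        IA: "\<And>i. s < i \<Longrightarrow> i \<le> t \<Longrightarrow> \<not> A i" and IC: "\<And>i. s \<le> i \<Longrightarrow> i \<le> t + 1 \<Longrightarrow> \<not> C i"
        by auto
      have A1: "\<not> A (t + 1)"
        using x_left[of "t + 1 - k"] IA[of "t + 1 - k"] IA[of "t + 1 - k - k"] IC[of "t + 1 - k"]
          clean[of "t + 1 - k"] ta step.hyps k_ge by auto
      have C2: "\<not> C (t + 1 + 1)"
        using y_left[of "t + 1"] IC[of "t + 1"] IC[of t] clean[of "t + 1"] A1 ta step.hyps k_ge
        by auto
      show "(\<forall>i. s < i \<and> i \<le> t + 1 \<longrightarrow> \<not> A i) \<and> (\<forall>i. s \<le> i \<and> i \<le> t + 1 + 1 \<longrightarrow> \<not> C i)"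
      proof (intro conjI allI impI)
        fix i
        show "\<not> A i" if "s < i \<and> i \<le> t + 1"
          using that A1 IA[of i] by (cases "i = t + 1") auto
        show "\<not> C i" if "s \<le> i \<and> i \<le> t + 1 + 1"
          using that C2 IC[of i] by (cases "i = t + 1 + 1") auto
      qed
    qed
  qed
  have IA: "\<not> A i" if "s < i" "i < a" for i
    using front[of "a - 1"] that a by auto
  have IC: "\<not> C i" if "s \<le> i" "i \<le> a" for i
    using front[of "a - 1"] that a by auto
  \<comment> \<open>\<open>x\<^sub>a\<close> is still forced, from behind by \<open>x\<^bsub>a-k\<^esub>\<close>, which is not a leak.\<close>
  have "\<not> A a"
    using x_left[of "a - k"] IA[of "a - k"] IA[of "a - k - k"] IC[of "a - k"] clean[of "a - k"]
      a k_ge by auto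
  then show ?thesis
    using IA[of i] IC[of i] i by (cases "i = a") auto
qed

lemma sweep_left:
  assumes window: "\<And>i. s \<le> i \<Longrightarrow> i \<le> s + 2 * k + 1 \<Longrightarrow> \<not> C i"
    and clean: "\<And>i. b < i \<Longrightarrow> i \<le> s + 2 * k + 1 \<Longrightarrow> \<not> LX i \<and> \<not> LY i"
    and b: "b < s"
    and i: "b \<le> i" "i < s + 2 * k + 1"
  shows "\<not> A i \<and> \<not> C i"
proof -
  interpret r: stalled k "\<lambda>i. A (- i)" "\<lambda>i. C (- i)" "\<lambda>i. LX (- i)" "\<lambda>i. LY (- i)"
    by (rule reflected)
  show ?thesis
    using r.sweep_right[of "- (s + 2 * k + 1)" "- b" "- i"] window clean b i by auto
qed

lemma sweep:
  assumes "\<And>i. s \<le> i \<Longrightarrow> i \<le> s + 2 * k + 1 \<Longrightarrow> \<not> C i"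
    and "\<And>i. b < i \<Longrightarrow> i < a \<Longrightarrow> \<not> LX i \<and> \<not> LY i"
    and "b < s" "s + 2 * k + 1 < a" "b \<le> i" "i \<le> a"
  shows "\<not> A i \<and> \<not> C i"
proof (cases "s < i")
  case True
  show ?thesis by (rule sweep_right[of s a]) (use assms True in auto)
next
  case False
  show ?thesis by (rule sweep_left[of s b]) (use assms False k_ge in auto)
qed

end

section \<open>An island between two leaks\<close>

lemma int_least:
  fixes P :: "int \<Rightarrow> bool"
  assumes "P i" and "\<And>j. P j \<Longrightarrow> a < j"
  obtains m where "P m" "\<And>j. P j \<Longrightarrow> m \<le> j"
proof -
  define m where "m = (LEAST d. P (a + int d))"
  have ex: "P (a + int (nat (i - a)))" using assms by force
  have "P (a + int m)" unfolding m_def by (rule LeastI) (rule ex)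
  moreover have "a + int m \<le> j" if "P j" for j
  proof -
    have "P (a + int (nat (j - a)))" using that assms(2)[OF that] by simp
    then have "m \<le> nat (j - a)" unfolding m_def by (rule Least_le)
    then show ?thesis using assms(2)[OF that] by simp
  qed
  ultimately show thesis by (rule that)
qed

text \<open>
  What is left to exclude after the fronts have stopped at leaks in the columns \<open>a\<close> and \<open>b\<close>. When
  both leaks share one column the fronts meet there, so here each column has at most one.
\<close>

locale island = stalled +
  fixes a b :: int
  assumes A_inside: "A i \<Longrightarrow> a < i \<and> i < b"
    and C_inside: "C i \<Longrightarrow> a < i \<and> i < b"
    and LX_ends: "LX i \<Longrightarrow> i = a \<or> i = b"
    and LY_ends: "LY i \<Longrightarrow> i = a \<or> i = b"
    and not_both: "\<not> (LX i \<and> LY i)"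
begin

lemma island_reflected:
  "island k (\<lambda>i. A (- i)) (\<lambda>i. C (- i)) (\<lambda>i. LX (- i)) (\<lambda>i. LY (- i)) (- b) (- a)"
proof -
  interpret r: stalled k "\<lambda>i. A (- i)" "\<lambda>i. C (- i)" "\<lambda>i. LX (- i)" "\<lambda>i. LY (- i)"
    by (rule reflected)
  show ?thesis
    by unfold_locales
      (use A_inside C_inside LX_ends LY_ends not_both in \<open>fastforce+\<close>)
qed

lemma clean: "a < i \<Longrightarrow> i < b \<Longrightarrow> \<not> LX i \<and> \<not> LY i"
  using LX_ends LY_ends by blast

lemma A_near_C:
  assumes "A i"
  shows "\<exists>j. C j \<and> j - 1 \<le> i \<and> i \<le> j + 1"
proof (cases "C i")
  case False
  then have "C (i - 1) \<or> C (i + 1)"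
    using y_down[of i] clean[of i] A_inside[of i] assms by blast
  then show ?thesis by force
qed force

text \<open>
  The least white \<open>x\<^sub>\<alpha>\<close> and the least white \<open>y\<^sub>u\<close> both have a blue neighbour on the left, \<open>x\<^bsub>\<alpha>-k\<^esub>\<close>
  and \<open>y\<^bsub>u-1\<^esub>\<close>, and each of these is either the leak at \<open>a\<close> or has a second white neighbour. Only one
  of them can be the leak. If the leak is \<open>x\<^sub>a\<close>, then \<open>x\<^bsub>u-1\<^esub>\<close> is white, so the island begins with
  \<open>x\<^sub>\<alpha>\<close>, and \<open>\<alpha> = a + k\<close>. Otherwise \<open>y\<^bsub>\<alpha>-k\<^esub>\<close> is white, so the island begins with \<open>y\<^sub>u\<close>, at
  least \<open>k\<close> before the first white \<open>x\<close> vertex. The conclusion covers both cases.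
\<close>

lemma left_end:
  assumes "C z"
  obtains lo where "A lo \<or> C lo" "C lo \<or> C (lo + 1)" "lo + k < b"
    "\<And>i. A i \<Longrightarrow> i = lo \<or> lo + k \<le> i" "\<And>i. C i \<Longrightarrow> lo \<le> i"
proof -
  obtain u where u: "C u" "\<And>j. C j \<Longrightarrow> u \<le> j"
    using int_least[of C z a] assms C_inside by blast
  obtain w where "A w"
    using x_up[of z] clean[of z] C_inside[of z] assms by blast
  then obtain \<alpha> where \<alpha>: "A \<alpha>" "\<And>j. A j \<Longrightarrow> \<alpha> \<le> j"
    using int_least[of A w a] A_inside by blast
  have \<alpha>_in: "a < \<alpha>" "\<alpha> < b" and u_in: "a < u" "u < b"
    using A_inside \<alpha>(1) C_inside u(1) by auto
  have before_u: "LY (u - 1) \<or> A (u - 1)"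
    using y_left[of "u - 1"] u(1) u(2)[of "u - 1"] u(2)[of "u - 1 - 1"] by auto
  have before_\<alpha>: "LX (\<alpha> - k) \<or> C (\<alpha> - k)"
    using x_left[of "\<alpha> - k"] \<alpha>(1) \<alpha>(2)[of "\<alpha> - k"] \<alpha>(2)[of "\<alpha> - k - k"] k_ge by auto
  show thesis
  proof (cases "LX a")
    case True
    then have "A (u - 1)"
      using before_u not_both[of a] LY_ends[of "u - 1"] u_in by auto
    then have \<alpha>u: "\<alpha> < u" using \<alpha>(2) by force
    then have "LX (\<alpha> - k)" using before_\<alpha> u(2)[of "\<alpha> - k"] k_ge by auto
    then have \<alpha>_eq: "\<alpha> = a + k" using LX_ends[of "\<alpha> - k"] \<alpha>_in k_ge by auto
    \<comment> \<open>For \<open>i > \<alpha>\<close> the vertex \<open>x\<^bsub>i-k\<^esub>\<close> lies beyond the leak; it is white itself or has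
      a second white neighbour, and neither can precede \<open>\<alpha>\<close>.\<close>
    have far: "i = \<alpha> \<or> \<alpha> + k \<le> i" if "A i" for i
    proof (cases "i = \<alpha>")
      case False
      then have "\<alpha> < i" using \<alpha>(2)[OF that] by simp
      then have "\<not> LX (i - k)"
        using \<alpha>_eq A_inside[OF that] clean[of "i - k"] k_ge by auto
      then have "A (i - k) \<or> A (i - k - k) \<or> C (i - k)"
        using x_left[of "i - k"] that by auto
      then show ?thesis
        using \<alpha>(2)[of "i - k"] \<alpha>(2)[of "i - k - k"] u(2)[of "i - k"] \<alpha>u k_ge by auto
    qed simp
    have C1: "C (\<alpha> + 1)"
      using y_down[of \<alpha>] \<alpha>(1) u(2)[of \<alpha>] u(2)[of "\<alpha> - 1"] \<alpha>u clean[of \<alpha>] \<alpha>_in by auto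
    then have "A (\<alpha> + 1 + k)"
      using x_up[of "\<alpha> + 1"] far[of "\<alpha> + 1"] \<alpha>(2)[of "\<alpha> + 1 - k"] k_ge
        clean[of "\<alpha> + 1"] C_inside[of "\<alpha> + 1"] by auto
    then have "\<alpha> + k < b" using A_inside by force
    then show thesis
      using that[of \<alpha>] \<alpha>(1) C1 far u(2) \<alpha>u by force
  next
    case False
    then have "C (\<alpha> - k)" using before_\<alpha> LX_ends[of "\<alpha> - k"] \<alpha>_in k_ge by auto
    then have "u + k \<le> \<alpha>" using u(2) by force
    then show thesis using that[of u] u \<alpha> \<alpha>_in by force
  qed
qed

text \<open>
  The contradiction is found within the first six columns of the island, where no \<open>x\<^sub>i\<close> with
  \<open>i \<noteq> lo\<close> is white. There the white \<open>y\<^sub>i\<close> must go on at least up to one of \<open>lo + 4\<close> and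
  \<open>lo + 5\<close>; but a white \<open>y\<^sub>i\<close> this far from \<open>lo\<close> makes \<open>x\<^bsub>i+k\<^esub>\<close> the very last white
  \<open>x\<close> vertex, so the island is too short for the white \<open>y\<^sub>c\<close> closer to \<open>lo\<close>,
  which makes \<open>x\<^bsub>c+k\<^esub>\<close> white too and hence \<open>c + 2 k \<le> hi\<close>.
\<close>

theorem island_empty:
  assumes spread: "\<And>i j. C i \<Longrightarrow> C j \<Longrightarrow> j - i \<le> 2 * k + 1"
  shows "\<not> A i \<and> \<not> C i"
proof -
  have "\<not> C z" for z
  proof
    assume "C z"
    then obtain lo where lo: "A lo \<or> C lo" "C lo \<or> C (lo + 1)" "lo + k < b"
      "\<And>i. A i \<Longrightarrow> i = lo \<or> lo + k \<le> i" "\<And>i. C i \<Longrightarrow> lo \<le> i"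
      using left_end by blast
    interpret r: island k "\<lambda>i. A (- i)" "\<lambda>i. C (- i)" "\<lambda>i. LX (- i)" "\<lambda>i. LY (- i)" "- b" "- a"
      by (rule island_reflected)
    obtain hi where hi: "A hi \<or> C hi" "\<And>i. A i \<Longrightarrow> i = hi \<or> i \<le> hi - k"
    proof -
      obtain h where "A (- h) \<or> C (- h)" "\<And>i. A (- i) \<Longrightarrow> i = h \<or> h + k \<le> i"
      proof (rule r.left_end[of "- z"])
        show "C (- (- z))" using \<open>C z\<close> by simp
      qed blast
      moreover have "i = - h \<or> i \<le> - h - k" if "A i" for i
        using calculation(2)[of "- i"] that by auto
      ultimately show thesis using that[of "- h"] by blast
    qed
    have width: "hi - lo \<le> 2 * k + 3"
    proof -
      obtain j1 where "C j1" "j1 - 1 \<le> lo" using lo(1) A_near_C by force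
      moreover obtain j2 where "C j2" "hi \<le> j2 + 1" using hi(1) A_near_C by force
      ultimately show ?thesis using spread[of j1 j2] by linarith
    qed
    have lo_in: "a \<le> lo" using lo(1) A_inside C_inside by force
    have up: "A (i + k)" if "C i" "lo < i" "i \<le> lo + 5" for i
      using x_up[of i] that lo(4)[of i] lo(4)[of "i - k"] clean[of i] C_inside[of i] k_ge by auto
    \<comment> \<open>If \<open>i + k \<noteq> hi\<close> then \<open>i + 2 k \<le> hi \<le> lo + 2 k + 3\<close>.\<close>
    have far: "i = hi - k \<or> i \<le> lo + 3" if "C i" "lo < i" "i \<le> lo + 5" for i
      using up[OF that] hi(2)[of "i + k"] width by auto
    have next_C: "C (i + 1) \<or> C (i + 2)" if "C i" "i \<le> lo + 3" for i
      using y_right[of "i + 1"] that lo(3) lo(4)[of "i + 1"] lo(5)[of i] C_inside[of i]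
        clean[of "i + 1"] k_ge by (auto simp: add.commute)
    obtain c where c: "C c" "lo < c" "c \<le> lo + 3"
      using lo(2) next_C[of lo] by force
    have "C (lo + 4) \<or> C (lo + 5)"
    proof -
      have "c = lo + 1 \<or> c = lo + 2 \<or> c = lo + 3" using c by auto
      then show ?thesis
        using c(1) next_C[of "lo + 1"] next_C[of "lo + 2"] next_C[of "lo + 3"]
        by (auto simp: add.commute)
    qed
    then obtain d where d: "C d" "lo + 4 \<le> d" "d \<le> lo + 5" by force
    then have "hi = d + k" using far[of d] by auto
    then show False
      using up[of c] hi(2)[of "c + k"] c d k_ge by auto
  qed
  then show ?thesis using A_near_C by blast
qed

end

section \<open>Closing up the cycle\<close>

context stalled
begin

text \<open>
  Discarding the white vertices outside \<open>a, \<dots>, b\<close> breaks none of the rules, because the columns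
  that see the inside, which are at distance at most \<open>k\<close>, see only blue vertices outside it.
\<close>

lemma island_between:
  assumes ab: "a < b"
    and blue_a: "\<And>i. a - 2 * k \<le> i \<Longrightarrow> i \<le> a \<Longrightarrow> \<not> A i \<and> \<not> C i"
    and blue_b: "\<And>i. b \<le> i \<Longrightarrow> i \<le> b + 2 * k \<Longrightarrow> \<not> A i \<and> \<not> C i"
    and clean: "\<And>i. a - 2 * k \<le> i \<Longrightarrow> i \<le> b + 2 * k \<Longrightarrow> i \<noteq> a \<Longrightarrow> i \<noteq> b \<Longrightarrow> \<not> LX i \<and> \<not> LY i"
    and not_both: "\<And>i. \<not> (LX i \<and> LY i)"
  shows "island k (\<lambda>i. A i \<and> a < i \<and> i < b) (\<lambda>i. C i \<and> a < i \<and> i < b)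
    (\<lambda>i. LX i \<and> (i = a \<or> i = b)) (\<lambda>i. LY i \<and> (i = a \<or> i = b)) a b"
proof (unfold_locales, goal_cases)
  case 1 show ?case by (rule k_ge)
next
  case (2 i)
  then show ?case
    using x_right[of i] clean[of i] blue_b[of i] blue_b[of "i + k"] k_ge by (smt (verit))
next
  case (3 i)
  then show ?case
    using x_left[of i] clean[of i] blue_a[of i] blue_a[of "i - k"] k_ge by (smt (verit))
next
  case (4 i)
  then show ?case
    using x_up[of i] clean[of i] blue_a[of "i - k"] blue_b[of "i + k"] k_ge by (smt (verit))
next
  case (5 i)
  then show ?case
    using y_right[of i] clean[of i] blue_b[of i] blue_b[of "i + 1"] k_ge by (smt (verit))
next
  case (6 i)
  then show ?case
    using y_left[of i] clean[of i] blue_a[of i] blue_a[of "i - 1"] k_ge by (smt (verit))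
next
  case (7 i)
  then show ?case
    using y_down[of i] clean[of i] blue_a[of "i - 1"] blue_b[of "i + 1"] k_ge by (smt (verit))
qed (use not_both in auto)

end

text \<open>
  The residues of \<open>p\<close> and \<open>q\<close> are the columns of the leaks; the representatives are the first
  ones after a window at \<open>s\<close> that contains no leak, so the preceding leak column is \<open>q - n\<close>. The
  condition \<open>next_window\<close> says that every white \<open>y\<^sub>i\<close> is followed, within the length of a gap, by a
  complete window.
\<close>

locale stalled_cycle = stalled +
  fixes n p q s :: int
  assumes A_periodic: "A (i + n) = A i"
    and C_periodic: "C (i + n) = C i"
    and leaks: "LX i \<or> LY i \<Longrightarrow> i mod n = p mod n \<or> i mod n = q mod n"
    and double_leak: "LX i \<Longrightarrow> LY i \<Longrightarrow> p mod n = q mod n"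
    and n_pos: "0 < n"
    and window: "s \<le> i \<Longrightarrow> i \<le> s + 2 * k + 1 \<Longrightarrow> \<not> C i \<and> \<not> LX i \<and> \<not> LY i"
    and pq_order: "s + 2 * k + 1 < p" "p \<le> q" "q < s + n"
    and next_window: "C i \<Longrightarrow>
      \<exists>t. i < t \<and> t \<le> i + 2 * k + 2 \<and> (\<forall>j. t \<le> j \<and> j \<le> t + 2 * k + 1 \<longrightarrow> \<not> C j)"
begin

lemma leak_positions:
  assumes "LX i \<or> LY i" "q - n \<le> i" "i \<le> p + n"
  shows "i \<in> {q - n, p, q, p + n}"
proof -
  have *: "i = j \<or> i = j + n \<or> i = j - n"
    if "i mod n = j mod n" "j - 2 * n < i" "i < j + 2 * n" for j
  proof -
    have "n dvd i - j" using that(1) by (simp add: mod_eq_dvd_iff)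
    then obtain m where m: "i - j = n * m" by (rule dvdE)
    have "n * m < n * 2" "n * (-2) < n * m" using m that by linarith+
    then have "m < 2" "-2 < m" using mult_less_cancel_left_pos[OF n_pos, of m 2]
        mult_less_cancel_left_pos[OF n_pos, of "- 2" m] by blast+
    then have "m = -1 \<or> m = 0 \<or> m = 1" by auto
    then show ?thesis using m by auto
  qed
  show ?thesis
    using leaks[OF assms(1)]
  proof
    assume "i mod n = p mod n"
    then show ?thesis using *[of p] assms pq_order n_pos k_ge by auto
  next
    assume "i mod n = q mod n"
    then show ?thesis using *[of q] assms pq_order n_pos k_ge by auto
  qed
qed

lemma shore_blue:
  assumes "q - n \<le> i" "i \<le> p"
  shows "\<not> A i \<and> \<not> C i"
proof (rule sweep[of s "q - n" p])
  fix j assume "q - n < j" "j < p"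
  then show "\<not> LX j \<and> \<not> LY j" using leak_positions[of j] pq_order n_pos k_ge by auto
qed (use assms window pq_order in auto)

lemma shore_blue':
  assumes "q \<le> i" "i \<le> p + n"
  shows "\<not> A i \<and> \<not> C i"
  using shore_blue[of "i - n"] A_periodic[of "i - n"] C_periodic[of "i - n"] assms by auto

lemma interior_blue:
  assumes "p < i" "i < q"
  shows "\<not> A i \<and> \<not> C i"
proof -
  \<comment> \<open>Otherwise there would be only one leak column and no room between \<open>p\<close> and \<open>q\<close>.\<close>
  have pq: "p mod n \<noteq> q mod n"
  proof
    assume "p mod n = q mod n"
    then have "n dvd q - p" by (metis mod_eq_dvd_iff)
    then obtain m where m: "q - p = n * m" by (rule dvdE)
    moreover have "n * 0 < n * m" using m assms by linarith
    then have "0 < m" using mult_less_cancel_left_pos[OF n_pos, of 0 m] by blast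
    moreover have "n * m < n * 1" using m pq_order k_ge by linarith
    then have "m < 1" using mult_less_cancel_left_pos[OF n_pos, of m 1] by blast
    ultimately show False by simp
  qed
  have clean: "\<not> LX j \<and> \<not> LY j" if "p < j" "j < q" for j
    using leak_positions[of j] that pq_order n_pos k_ge by auto
  show ?thesis
  proof (cases "\<exists>t. p < t \<and> t + 2 * k + 1 < q \<and> (\<forall>j. t \<le> j \<and> j \<le> t + 2 * k + 1 \<longrightarrow> \<not> C j)")
    case True
    then obtain t where "p < t" "t + 2 * k + 1 < q" "\<forall>j. t \<le> j \<and> j \<le> t + 2 * k + 1 \<longrightarrow> \<not> C j"
      by blast
    then show ?thesis using sweep[of t p q i] clean assms by auto
  next
    case no_window: False
    interpret I: island k "\<lambda>i. A i \<and> p < i \<and> i < q" "\<lambda>i. C i \<and> p < i \<and> i < q"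
      "\<lambda>i. LX i \<and> (i = p \<or> i = q)" "\<lambda>i. LY i \<and> (i = p \<or> i = q)" p q
    proof (rule island_between)
      show "p < q" using assms by simp
      show "\<not> A j \<and> \<not> C j" if "p - 2 * k \<le> j" "j \<le> p" for j
        using shore_blue[of j] that pq_order by auto
      show "\<not> A j \<and> \<not> C j" if "q \<le> j" "j \<le> q + 2 * k" for j
        using shore_blue'[of j] that pq_order by auto
      show "\<not> LX j \<and> \<not> LY j" if "p - 2 * k \<le> j" "j \<le> q + 2 * k" "j \<noteq> p" "j \<noteq> q" for j
        using leak_positions[of j] that pq_order by auto
      show "\<not> (LX j \<and> LY j)" for j using double_leak pq by blast
    qed
    have "j' - j \<le> 2 * k + 1" if "C j \<and> p < j \<and> j < q" "C j' \<and> p < j' \<and> j' < q" for j j'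
    proof (rule ccontr)
      assume "\<not> j' - j \<le> 2 * k + 1"
      moreover obtain t where t: "j < t" "t \<le> j + 2 * k + 2"
        "\<forall>i. t \<le> i \<and> i \<le> t + 2 * k + 1 \<longrightarrow> \<not> C i"
        using next_window[of j] \<open>C j \<and> _\<close> by blast
      ultimately have "t + 2 * k + 1 < j'"
        using that by (cases "j' \<le> t + 2 * k + 1") auto
      moreover have "p < t" using t that by linarith
      ultimately show False using no_window t(3) that by fastforce
    qed
    then show ?thesis using I.island_empty[of i] assms by blast
  qed
qed

theorem all_blue: "\<not> A i \<and> \<not> C i"
proof -
  have per: "A (j + int m * n) = A j \<and> C (j + int m * n) = C j" for m j
  proof (induction m)
    case (Suc m)
    then show ?case
      using A_periodic[of "j + int m * n"] C_periodic[of "j + int m * n"] by (simp add: algebra_simps)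
  qed simp
  have one_period: "\<not> A j \<and> \<not> C j" if "q - n \<le> j" "j \<le> q" for j
    using shore_blue[of j] interior_blue[of j] shore_blue'[of j] that pq_order n_pos k_ge
    by (cases "j \<le> p"; cases "j < q") auto
  define r where "r = q - n + (i - (q - n)) mod n"
  define m where "m = (i - (q - n)) div n"
  have r: "q - n \<le> r" "r \<le> q" using n_pos by (auto simp: r_def less_imp_le)
  have i: "i = r + m * n" by (simp add: r_def m_def)
  show ?thesis
  proof (cases "0 \<le> m")
    case True
    then show ?thesis using per[of r "nat m"] i one_period[OF r] by simp
  next
    case False
    then have "r = i + int (nat (- m)) * n" using i by (simp add: algebra_simps)
    then show ?thesis using per[of i "nat (- m)"] one_period[OF r] by simp
  qed
qed

end

section \<open>Leaky forcing and forts\<close>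

text \<open>
  As long as some vertices are white, they do not form a fort, so some blue vertex can force.
  The blue set \<open>B\<close> is generalised from \<open>S\<close> for the induction on the number of white vertices.
\<close>

lemma leaky_forcing_by_forts:
  fixes G :: "'a pair_pre_digraph"
  assumes fin: "finite (pverts G)"
    and B: "S \<subseteq> B" "B \<subseteq> pverts G"
    and fort: "\<And>W. \<lbrakk>W \<subseteq> pverts G; W \<inter> S = {};
      \<And>v w. v \<in> pverts G - W - L \<Longrightarrow> {w \<in> W. (v, w) \<in> parcs G} \<noteq> {w}\<rbrakk> \<Longrightarrow> W = {}"
  shows "(leaky_step G L)\<^sup>*\<^sup>* B (pverts G)"
  using B
proof (induction "card (pverts G - B)" arbitrary: B rule: less_induct)
  case less
  have nbrs: "white_neighbors G B v = {w \<in> pverts G - B. (v, w) \<in> parcs G}" for v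
    by (auto simp: white_neighbors_def)
  show ?case
  proof (cases "pverts G - B = {}")
    case True
    then have "B = pverts G" using less.prems by auto
    then show ?thesis by simp
  next
    case False
    have "\<exists>v w. v \<in> pverts G - (pverts G - B) - L \<and> {w \<in> pverts G - B. (v, w) \<in> parcs G} = {w}"
      using fort[of "pverts G - B"] False less.prems by blast
    then obtain v w where v: "v \<in> B" "v \<notin> L" "white_neighbors G B v = {w}"
      using less.prems nbrs by auto
    then have w: "w \<in> pverts G - B" by (auto simp: white_neighbors_def)
    have "card (pverts G - insert w B) < card (pverts G - B)"
      by (rule psubset_card_mono) (use fin w in auto)
    then have "(leaky_step G L)\<^sup>*\<^sup>* (insert w B) (pverts G)"
      using less.hyps[of "insert w B"] less.prems w by auto
    moreover have "leaky_step G L B (insert w B)"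
      using v by (auto simp: leaky_step_def)
    ultimately show ?thesis by (meson converse_rtranclp_into_rtranclp)
  qed
qed

section \<open>The alternating set of outer vertices\<close>

definition alternating_set :: "nat \<Rightarrow> nat \<Rightarrow> petersen_vertex set" where
  "alternating_set n k = Y ` {r. r < n \<and> r mod (4 * k + 4) < 2 * k + 2}"

lemma card_alternating_set:
  assumes "n \<le> m * (4 * k + 4)"
  shows "card (alternating_set n k) \<le> m * (2 * k + 2)"
proof -
  let ?f = "\<lambda>(j, t). Y (j * (4 * k + 4) + t)"
  have "alternating_set n k \<subseteq> ?f ` ({..<m} \<times> {..<2 * k + 2})"
  proof
    fix v assume "v \<in> alternating_set n k"
    then obtain r where r: "v = Y r" "r < n" "r mod (4 * k + 4) < 2 * k + 2"
      by (auto simp: alternating_set_def)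
    have "r div (4 * k + 4) < m" using r(2) assms
      by (metis less_mult_imp_div_less order.strict_trans2)
    moreover have "v = ?f (r div (4 * k + 4), r mod (4 * k + 4))"
      using r(1) div_mult_mod_eq[of r "4 * k + 4"] by (simp del: div_mult_mod_eq)
    ultimately show "v \<in> ?f ` ({..<m} \<times> {..<2 * k + 2})" using r(3) by blast
  qed
  then have "card (alternating_set n k) \<le> card ({..<m} \<times> {..<2 * k + 2})"
    by (rule surj_card_le[rotated]) simp
  then show ?thesis by (simp add: card_cartesian_product)
qed

text \<open>
  The next window may start at the end of the current block or at the end of the period, whichever
  comes first. If the last window of the period is cut short, then the first window of
  the next period follows immediately, so that \<open>2 k + 2\<close> consecutive indices are still covered.
\<close>

lemma full_window_after_gap:
  fixes n k i :: int
  assumes n: "2 * k + 2 \<le> n" and k: "0 \<le> k"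
    and i: "\<not> (i mod n) mod (4 * k + 4) < 2 * k + 2"
  shows "\<exists>t. i < t \<and> t \<le> i + 2 * k + 2 \<and>
    (\<forall>j. t \<le> j \<and> j \<le> t + 2 * k + 1 \<longrightarrow> (j mod n) mod (4 * k + 4) < 2 * k + 2)"
proof -
  define M where "M = 4 * k + 4"
  define r where "r = i mod n"
  define z where "z = n * (i div n)"
  have M: "0 < M" and n0: "0 < n" using k n by (auto simp: M_def)
  have i_eq: "i = z + r" by (simp add: z_def r_def)
  have r: "0 \<le> r" "r < n" using n0 by (auto simp: r_def)
  \<comment> \<open>\<open>e\<close> is the end of the block of \<open>r\<close>.\<close>
  define e where "e = M * (r div M + 1)"
  have rm: "r mod M < M" "2 * k + 2 \<le> r mod M" using M i by (auto simp: M_def r_def)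
  have e: "e = r - r mod M + M" by (simp add: e_def algebra_simps minus_mod_eq_mult_div)
  have e_r: "r < e" "e \<le> r + 2 * k + 2" "0 \<le> e" using e rm r by (auto simp: M_def)
  have modn: "(z + j) mod n = j mod n" for j by (simp add: z_def)
  \<comment> \<open>The window at the beginning of the next period.\<close>
  have first: "((z + j) mod n) mod M < 2 * k + 2" if "n \<le> j" "j \<le> n + 2 * k + 1" for j
  proof -
    have "j < n + n" using that n by linarith
    then have "j mod n = j - n" using that n0
      by (metis add.commute diff_ge_0_iff_ge diff_less_eq minus_mod_self2 mod_pos_pos_trivial)
    then show ?thesis using that k by (simp add: modn M_def)
  qed
  show ?thesis
  proof (cases "e < n")
    case True
    have here: "((z + j) mod n) mod M < 2 * k + 2" if "e \<le> j" "j \<le> e + 2 * k + 1" "j < n" for j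
    proof -
      have "j mod n = j" using that e_r by simp
      moreover have "j mod M = j - e"
      proof -
        have "(M * (r div M + 1) + (j - e)) mod M = j - e"
          using that k by (simp add: M_def)
        then show ?thesis by (simp add: e_def)
      qed
      ultimately show ?thesis using that by (simp add: modn)
    qed
    have "(j mod n) mod M < 2 * k + 2" if "z + e \<le> j" "j \<le> z + e + 2 * k + 1" for j
      using here[of "j - z"] first[of "j - z"] that True by (cases "j - z < n") auto
    then show ?thesis
      by (intro exI[of _ "z + e"]) (use e_r i_eq M_def in auto)
  next
    case False
    have "(j mod n) mod M < 2 * k + 2" if "z + n \<le> j" "j \<le> z + n + 2 * k + 1" for j
      using first[of "j - z"] that by auto
    then show ?thesis
      by (intro exI[of _ "z + n"]) (use e_r r i_eq M_def False in auto)
  qed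
qed

section \<open>Unrolling the generalized Petersen graph\<close>

context
  fixes n k :: nat
  assumes k7: "7 \<le> k" and n10: "10 * k + 10 \<le> n"
begin

definition "xv i = X (nat (i mod int n))"
definition "yv i = Y (nat (i mod int n))"

lemma nat_mod_shift: "nat ((i + int d) mod int n) = (nat (i mod int n) + d) mod n"
proof -
  have "(i + int d) mod int n = int ((nat (i mod int n) + d) mod n)"
    using n10 by (simp add: zmod_int mod_add_left_eq)
  then show ?thesis by simp
qed

lemma shift_back:
  assumes "j < n" "(j + d) mod n = nat (i mod int n)"
  shows "j = nat ((i - int d) mod int n)"
proof -
  have "int ((j + d) mod n) = i mod int n" using assms(2) n10 by simp
  then have "(int j + int d) mod int n = i mod int n" by (simp add: zmod_int)
  then have "(int j + int d - int d) mod int n = (i - int d) mod int n"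
    by (rule mod_diff_cong) simp
  then have "int j = (i - int d) mod int n" using assms(1) by simp
  then show ?thesis by (metis nat_int)
qed

lemma x_arc:
  assumes "(xv i, w) \<in> parcs (generalized_petersen n k)"
  shows "w = xv (i - int k) \<or> w = xv (i + int k) \<or> w = yv i"
proof -
  define r where "r = nat (i mod int n)"
  have "(X r, w) \<in> parcs (generalized_petersen n k)" using assms by (simp add: xv_def r_def)
  then have "w = X ((r + k) mod n) \<or> w = Y r \<or> (\<exists>j<n. w = X j \<and> (j + k) mod n = r)"
    by (auto simp: generalized_petersen_def symcl_def petersen_edges_def)
  then show ?thesis
    using shift_back[of _ k i] unfolding xv_def yv_def nat_mod_shift r_def by blast
qed

lemma y_arc:
  assumes "(yv i, w) \<in> parcs (generalized_petersen n k)"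
  shows "w = yv (i - 1) \<or> w = yv (i + 1) \<or> w = xv i"
proof -
  define r where "r = nat (i mod int n)"
  have "(Y r, w) \<in> parcs (generalized_petersen n k)" using assms by (simp add: yv_def r_def)
  then have "w = Y ((r + 1) mod n) \<or> w = X r \<or> (\<exists>j<n. w = Y j \<and> (j + 1) mod n = r)"
    by (auto simp: generalized_petersen_def symcl_def petersen_edges_def)
  then show ?thesis
    using shift_back[of _ 1 i] nat_mod_shift[of i 1] unfolding xv_def yv_def r_def of_nat_1 by metis
qed

lemma arcs:
  "(xv i, xv (i + int k)) \<in> parcs (generalized_petersen n k)"
  "(xv i, yv i) \<in> parcs (generalized_petersen n k)"
  "(yv i, xv i) \<in> parcs (generalized_petersen n k)"
  "(yv i, yv (i + 1)) \<in> parcs (generalized_petersen n k)"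
  "(xv (i + int k), xv i) \<in> parcs (generalized_petersen n k)"
  "(yv (i + 1), yv i) \<in> parcs (generalized_petersen n k)"
proof -
  define r where "r = nat (i mod int n)"
  have r: "r < n" using n10 by (simp add: r_def nat_less_iff)
  have e: "xv i = X r" "yv i = Y r" "xv (i + int k) = X ((r + k) mod n)" "yv (i + 1) = Y ((r + 1) mod n)"
    using nat_mod_shift[of i k] nat_mod_shift[of i 1] by (simp_all add: xv_def yv_def r_def)
  show
  "(xv i, xv (i + int k)) \<in> parcs (generalized_petersen n k)"
  "(xv i, yv i) \<in> parcs (generalized_petersen n k)"
  "(yv i, xv i) \<in> parcs (generalized_petersen n k)"
  "(yv i, yv (i + 1)) \<in> parcs (generalized_petersen n k)"
  "(xv (i + int k), xv i) \<in> parcs (generalized_petersen n k)"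
  "(yv (i + 1), yv i) \<in> parcs (generalized_petersen n k)"
    unfolding e using r by (auto simp: generalized_petersen_def symcl_def petersen_edges_def)
qed

lemma arcs_rev:
  "(xv i, xv (i - int k)) \<in> parcs (generalized_petersen n k)"
  "(yv i, yv (i - 1)) \<in> parcs (generalized_petersen n k)"
  using arcs(5)[of "i - int k"] arcs(6)[of "i - 1"] by simp_all

lemma vertex: "xv i \<in> pverts (generalized_petersen n k)" "yv i \<in> pverts (generalized_petersen n k)"
proof -
  have "nat (i mod int n) < n" using n10 by (simp add: nat_less_iff)
  then show "xv i \<in> pverts (generalized_petersen n k)" "yv i \<in> pverts (generalized_petersen n k)"
    by (auto simp: generalized_petersen_def xv_def yv_def)
qed


lemma xv_period: "xv (i + int n) = xv i" "yv (i + int n) = yv i"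
  by (simp_all add: xv_def yv_def)

lemma stalled_if_fort:
  fixes W L :: "petersen_vertex set"
  assumes fort: "\<And>v w. v \<in> pverts (generalized_petersen n k) - W - L \<Longrightarrow>
    {w \<in> W. (v, w) \<in> parcs (generalized_petersen n k)} \<noteq> {w}"
  shows "stalled (int k) (\<lambda>i. xv i \<in> W) (\<lambda>i. yv i \<in> W) (\<lambda>i. xv i \<in> L) (\<lambda>i. yv i \<in> L)"
proof -
  have x: "{w \<in> W. (xv i, w) \<in> parcs (generalized_petersen n k)} =
    W \<inter> {xv (i - int k), xv (i + int k), yv i}" for i
    using x_arc[of i] arcs[of i] arcs_rev[of i] by auto
  have y: "{w \<in> W. (yv i, w) \<in> parcs (generalized_petersen n k)} =
    W \<inter> {yv (i - 1), yv (i + 1), xv i}" for i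
    using y_arc[of i] arcs[of i] arcs_rev[of i] by auto
  have fx: "W \<inter> {xv (i - int k), xv (i + int k), yv i} \<noteq> {w}" if "xv i \<notin> W" "xv i \<notin> L" for i w
    using fort[of "xv i" w] vertex[of i] that x[of i] by auto
  have fy: "W \<inter> {yv (i - 1), yv (i + 1), xv i} \<noteq> {w}" if "yv i \<notin> W" "yv i \<notin> L" for i w
    using fort[of "yv i" w] vertex[of i] that y[of i] by auto
  show ?thesis
  proof (unfold_locales, goal_cases)
    case 1 show ?case using k7 by simp
  next
    case (2 i) then show ?case using fx[of i "xv (i - int k)"] by blast
  next
    case (3 i) then show ?case using fx[of i "xv (i + int k)"] by blast
  next
    case (4 i) then show ?case using fx[of i "yv i"] by blast
  next
    case (5 i) then show ?case using fy[of i "yv (i - 1)"] by blast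
  next
    case (6 i) then show ?case using fy[of i "yv (i + 1)"] by blast
  next
    case (7 i) then show ?case using fy[of i "xv i"] by blast
  qed
qed

text \<open>
  The windows at \<open>0\<close>, \<open>4 k + 4\<close> and \<open>8 k + 8\<close> are complete since \<open>n \<ge> 10 k + 10\<close>, and two leaks
  spoil at most two of them. From the remaining one the cycle is cut open at the two leaks.
\<close>

lemma alternating_set_hits_forts:
  fixes W L :: "petersen_vertex set"
  assumes L: "L \<subseteq> pverts (generalized_petersen n k)" "card L = 2"
    and W: "W \<subseteq> pverts (generalized_petersen n k)" "W \<inter> alternating_set n k = {}"
    and fort: "\<And>v w. v \<in> pverts (generalized_petersen n k) - W - L \<Longrightarrow>
      {w \<in> W. (v, w) \<in> parcs (generalized_petersen n k)} \<noteq> {w}"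
  shows "W = {}"
proof -
  interpret S: stalled "int k" "\<lambda>i. xv i \<in> W" "\<lambda>i. yv i \<in> W" "\<lambda>i. xv i \<in> L" "\<lambda>i. yv i \<in> L"
    by (rule stalled_if_fort) (rule fort)
  define N where "N = int n"
  have N0: "0 < N" "10 * int k + 10 \<le> N" using n10 by (auto simp: N_def)
  have nat_N: "nat (i mod N) < n" "int (nat (i mod N)) = i mod N" for i
    using N0 by (auto simp: N_def nat_less_iff)
  obtain v1 v2 where v: "L = {v1, v2}" "v1 \<noteq> v2" using L(2) by (meson card_2_iff)
  define col where "col v = (case v of X r \<Rightarrow> int r | Y r \<Rightarrow> int r)" for v
  have col: "col (xv i) = i mod N" "col (yv i) = i mod N" for i
    using nat_N by (auto simp: col_def xv_def yv_def N_def[symmetric])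
  have col_range: "0 \<le> col v \<and> col v < N" if "v \<in> L" for v
    using L(1) that by (auto simp: col_def generalized_petersen_def N_def)
  have white_gap: "\<not> (i mod N) mod (4 * int k + 4) < 2 * int k + 2" if "yv i \<in> W" for i
  proof
    assume less: "(i mod N) mod (4 * int k + 4) < 2 * int k + 2"
    define r where "r = nat (i mod N)"
    have "int (r mod (4 * k + 4)) < int (2 * k + 2)" using less nat_N(2)[of i]
      by (simp add: r_def zmod_int add.commute)
    then have "r mod (4 * k + 4) < 2 * k + 2" by (simp only: of_nat_less_iff)
    then have "yv i \<in> alternating_set n k"
      using nat_N(1)[of i] by (auto simp: alternating_set_def yv_def r_def N_def)
    then show False using that W(2) by auto
  qed
  obtain s where s: "s \<in> {0, 4 * int k + 4, 8 * int k + 8}"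
    "\<not> (s \<le> col v1 \<and> col v1 \<le> s + 2 * int k + 1)" "\<not> (s \<le> col v2 \<and> col v2 \<le> s + 2 * int k + 1)"
  proof -
    have "\<exists>s \<in> {0, 4 * int k + 4, 8 * int k + 8}.
      \<not> (s \<le> col v1 \<and> col v1 \<le> s + 2 * int k + 1) \<and> \<not> (s \<le> col v2 \<and> col v2 \<le> s + 2 * int k + 1)"
      by simp linarith
    then show thesis using that by blast
  qed
  have s_win: "0 \<le> s" "s + 2 * int k + 1 < N" using s(1) N0 by auto
  have window: "yv i \<notin> W \<and> xv i \<notin> L \<and> yv i \<notin> L" if i: "s \<le> i" "i \<le> s + 2 * int k + 1" for i
  proof -
    have iN: "i mod N = i" using i s_win by simp
    have "i = (4 * int k + 4) * 0 + (i - s) \<or> i = (4 * int k + 4) * 1 + (i - s) \<or>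
      i = (4 * int k + 4) * 2 + (i - s)" using s(1) by auto
    moreover have "((4 * int k + 4) * z + (i - s)) mod (4 * int k + 4) = i - s" for z
      using i by simp
    ultimately have "i mod (4 * int k + 4) = i - s" by metis
    then have "yv i \<notin> W" using white_gap[of i] iN i by auto
    moreover have "i \<noteq> col v1" "i \<noteq> col v2" using s i by auto
    ultimately show ?thesis using col[of i] iN v(1) by auto
  qed
  define p where "p = s + (col v1 - s) mod N"
  define q where "q = s + (col v2 - s) mod N"
  have leak_col: "s + 2 * int k + 1 < s + (c - s) mod N \<and> s + (c - s) mod N < s + N \<and>
    (s + (c - s) mod N) mod N = c mod N"
    if "0 \<le> c" "c < N" "\<not> (s \<le> c \<and> c \<le> s + 2 * int k + 1)" for c
  proof (cases "s \<le> c")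
    case True
    then have "(c - s) mod N = c - s" using that s_win by simp
    then show ?thesis using that True s_win by auto
  next
    case False
    have "(c - s) mod N = (c - s + N) mod N" by simp
    also have "\<dots> = c - s + N" using that False s_win by (intro mod_pos_pos_trivial) auto
    finally show ?thesis using that False s_win by auto
  qed
  have p: "s + 2 * int k + 1 < p" "p < s + N" "p mod N = col v1"
    using leak_col[of "col v1"] col_range[of v1] v(1) s(2) by (auto simp: p_def)
  have q: "s + 2 * int k + 1 < q" "q < s + N" "q mod N = col v2"
    using leak_col[of "col v2"] col_range[of v2] v(1) s(3) by (auto simp: q_def)
  have leaks: "i mod N = p mod N \<or> i mod N = q mod N" if "xv i \<in> L \<or> yv i \<in> L" for i
    using that v(1) col[of i] p(3) q(3) by auto
  have double: "p mod N = q mod N" if "xv i \<in> L" "yv i \<in> L" for i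
  proof -
    have "xv i \<noteq> yv i" by (simp add: xv_def yv_def)
    then have "{v1, v2} = {xv i, yv i}" using that v by auto
    then show ?thesis using v(2) col[of i] p(3) q(3) by (auto simp: doubleton_eq_iff)
  qed
  have next_window: "\<exists>t. i < t \<and> t \<le> i + 2 * int k + 2 \<and>
    (\<forall>j. t \<le> j \<and> j \<le> t + 2 * int k + 1 \<longrightarrow> yv j \<notin> W)" if "yv i \<in> W" for i
    using full_window_after_gap[of "int k" N i] white_gap[OF that] white_gap N0 by force
  have "stalled_cycle (int k) (\<lambda>i. xv i \<in> W) (\<lambda>i. yv i \<in> W) (\<lambda>i. xv i \<in> L) (\<lambda>i. yv i \<in> L)
    N (min p q) (max p q) s"
  proof (unfold_locales, goal_cases)
    case (1 i) show ?case by (simp add: N_def xv_period)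
  next
    case (2 i) show ?case by (simp add: N_def xv_period)
  next
    case (3 i) then show ?case using leaks[of i] by (auto simp: min_def max_def)
  next
    case (4 i) then show ?case using double[of i] by (auto simp: min_def max_def)
  next
    case 5 show ?case by (rule N0)
  next
    case (6 i) then show ?case by (rule window)
  next
    case 7 show ?case using p q by simp
  next
    case 8 show ?case by simp
  next
    case 9 show ?case using p q by simp
  next
    case (10 i) then show ?case by (rule next_window)
  qed
  then have blue: "xv i \<notin> W \<and> yv i \<notin> W" for i by (rule stalled_cycle.all_blue)
  show ?thesis
  proof (rule ccontr)
    assume "W \<noteq> {}"
    then obtain w where w: "w \<in> W" by blast
    then obtain r where "r < n" "w = X r \<or> w = Y r"
      using W(1) by (auto simp: generalized_petersen_def)
    then have "w = xv (int r) \<or> w = yv (int r)" by (auto simp: xv_def yv_def)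
    then show False using w blue by auto
  qed
qed

end

section \<open>The bound\<close>

theorem theorem4p16:
  fixes n k :: nat
  assumes "7 \<le> k" and "real k \<le> (real n - 1) / 2" and "n \<ge> 10 * k + 10"
  shows "int (leaky_forcing_number 2 (generalized_petersen n k))
           \<le> \<lceil>real n / real (4 * k + 4)\<rceil> * int (2 * k + 2)"
proof -
  let ?G = "generalized_petersen n k"
  have "leaky_forcing_set ?G 2 (alternating_set n k)"
    unfolding leaky_forcing_set_def
  proof (intro conjI allI impI)
    show S: "alternating_set n k \<subseteq> pverts ?G"
      by (auto simp: alternating_set_def generalized_petersen_def)
    fix L assume "L \<subseteq> pverts ?G \<and> card L = 2"
    then show "(leaky_step ?G L)\<^sup>*\<^sup>* (alternating_set n k) (pverts ?G)"
      using alternating_set_hits_forts[OF assms(1,3)] S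
      by (intro leaky_forcing_by_forts[of ?G "alternating_set n k"])
        (auto simp: generalized_petersen_def)
  qed
  then have "leaky_forcing_number 2 ?G \<le> card (alternating_set n k)"
    by (rule leaky_forcing_number_le)
  also have "\<dots> \<le> nat \<lceil>real n / real (4 * k + 4)\<rceil> * (2 * k + 2)"
  proof (rule card_alternating_set)
    have "real n / real (4 * k + 4) \<le> real (nat \<lceil>real n / real (4 * k + 4)\<rceil>)"
      by (rule real_nat_ceiling_ge)
    then have "real n \<le> real (nat \<lceil>real n / real (4 * k + 4)\<rceil> * (4 * k + 4))"
      by (simp only: pos_divide_le_eq of_nat_mult)
    then show "n \<le> nat \<lceil>real n / real (4 * k + 4)\<rceil> * (4 * k + 4)"
      by (simp only: of_nat_le_iff)
  qed
  finally have "int (leaky_forcing_number 2 ?G) \<le>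
      int (nat \<lceil>real n / real (4 * k + 4)\<rceil> * (2 * k + 2))"
    by (simp only: of_nat_le_iff)
  moreover have "- 1 < real n / real (4 * k + 4)"
    by (rule less_le_trans[of _ 0]) simp_all
  then have "0 \<le> \<lceil>real n / real (4 * k + 4)\<rceil>" by (simp only: zero_le_ceiling)
  then have nonneg: "int (nat \<lceil>real n / real (4 * k + 4)\<rceil>) = \<lceil>real n / real (4 * k + 4)\<rceil>"
    by (rule nat_0_le)
  ultimately show ?thesis by (simp only: of_nat_mult nonneg)
qed

end
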